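(* Let $(M_n)_{n\ge1}$, $M_n=\begin{pmatrix}a_n&b_n\\ c_n&d_n\end{pmatrix}$, be a sequence of $2\times2$ matrices with nonnegative real entries such that the set $\{M_n : n\ge1\}$ is finite. Then $M_nM_{n-1}\cdots M_{n_0}$ converges to a nonnull limit, for any fixed $n_0$ and when $n\to\infty$, if and only if one of the following holds: (1) either the $M_n$ have, from a certain rank, a common right-eigenvector $\begin{pmatrix}v_1\\ v_2\end{pmatrix}$ for the eigenvalue $1$, with $v_1v_2>0$, and the left-product $S_nS_{n-1}\cdots S_{n_0}$ of the stochastic matrices $S_n=\begin{pmatrix}1/v_1&0\\ 0&1/v_2\end{pmatrix}M_n\begin{pmatrix}v_1&0\\ 0&v_2\end{pmatrix}$, from any rank $n_0$, converges as $n\to\infty$; (2) or the $M_n$ have, from a certain rank, $\begin{pmatrix}1\\ 0\end{pmatrix}$ as common right-eigenvector for the eigenvalue $1$, the sum $\sum_{n=n_0}^\infty b_n d_{n-1}\cdots d_{n_0}$ is finite and $d_n\cdots d_{n_0}$ converges, for any $n_0$, when $n\to\infty$; (3) or the $M_n$ have, from a certain rank, $\begin{pmatrix}0\\ 1\end{pmatrix}$ as common right-eigenvector for the eigenvalue $1$, the sum $\sum_{n=n_0}^\infty c_n a_{n-1}\cdots a_{n_0}$ is finite and $a_n\cdots a_{n_0}$ converges, for any $n_0$, when $n\to\infty$.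
   Context: Here $n_0$ ranges over the positive integers. "From a certain rank" means for all sufficiently large $n$. A square matrix is stochastic if its entries are nonnegative and each of its rows sums to $1$; the matrices $S_n$ in (1) are stochastic for those $n$ for which $M_n$ has the common eigenvector, that is, from a certain rank. Convergence of matrices is entrywise; "nonnull" means different from the zero matrix. Convergence of a product such as $d_n\cdots d_{n_0}$ means that the sequence indexed by $n$ has a finite limit (possibly $0$). The empty product ($d_{n-1}\cdots d_{n_0}$ or $a_{n-1}\cdots a_{n_0}$ for $n=n_0$) equals $1$.
   Formalization: The products must converge for every n_0, but the limit is required to be nonnull only for all sufficiently large n_0; with nonnull for every n_0 the equivalence fails (M_1 = 0, M_n = identity for n ≥ 2 satisfies (1) but has null limit from n_0 = 1). *)

theory Defs
  imports "HOL-Analysis.Analysis"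
begin

definition mat2 :: "real \<Rightarrow> real \<Rightarrow> real \<Rightarrow> real \<Rightarrow> real^2^2" where
  "mat2 a b c d = vector [vector [a, b], vector [c, d]]"

(* left_product M m n = M n ** M (n - 1) ** ... ** M m, and the identity if n < m *)
definition left_product :: "(nat \<Rightarrow> real^'k^'k) \<Rightarrow> nat \<Rightarrow> nat \<Rightarrow> real^'k^'k" where
  "left_product M m n = fold (\<lambda>k P. M k ** P) [m..<Suc n] (mat 1)"

definition right_eigenvector :: "real^'k^'k \<Rightarrow> real \<Rightarrow> real^'k \<Rightarrow> bool" where
  "right_eigenvector A e v \<longleftrightarrow> v \<noteq> 0 \<and> A *v v = e *s v"

definition stochastic :: "real^'k^'k \<Rightarrow> bool" where
  "stochastic A \<longleftrightarrow> (\<forall>i j. A $ i $ j \<ge> 0) \<and> (\<forall>i. (\<Sum>j\<in>UNIV. A $ i $ j) = 1)"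

(* In the theorem, convergence of the products is required from every rank m \<ge> 1, but the limit
   is required to be nonnull only for all sufficiently large m. With nonnullity for every m the
   equivalence would be false: if M 1 = 0 and M n = mat 1 for n \<ge> 2, then the products from
   rank 1 vanish, although vector [1, 1] is a common eigenvector from rank 2 on and the products
   of the S n (= M n) converge from every rank. The three conditions on the right-hand side depend
   only on the tail of the sequence, so nonnullity has to be asked of the tail as well. *)

end

theory Submission
  imports Defs
begin

text \<open>
  Write \<open>P n = M n ** \<dots> ** M m\<close> and suppose that \<open>P n\<close> tends to \<open>L\<close>. Since \<open>P n = M n ** P (n - 1)\<close>
  and the factors take finitely many values, every matrix \<open>A\<close> that occurs infinitely often among
  them satisfies \<open>A ** L = L\<close>; the other values stop occurring, so \<open>M n ** L = L\<close> from a certain rank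
  (\<open>eventually_factor_fixes_limit\<close>). A nonzero column of \<open>L\<close> is therefore a common eigenvector for
  the eigenvalue 1, and it has nonnegative entries (\<open>common_nonneg_eigenvector\<close>). Conversely, a
  common eigenvector \<open>v\<close> forces \<open>P n *v v = v\<close> for large \<open>m\<close> and hence a nonnull limit, so that the
  theorem reduces to rewriting convergence according to which entries of \<open>v\<close> vanish.

  If no entry vanishes, conjugation by the diagonal matrix of \<open>v\<close> commutes with taking products, so
  the products of the \<open>M n\<close> and of the \<open>S n\<close> converge together
  (\<open>convergent_left_product_rescaled_iff\<close>). If \<open>v\<close> is a multiple of a basis vector, the factors are
  triangular from a certain rank, with 1 as one of the diagonal entries; the other two entries of
  their product are a partial sum of the series and a partial product of the diagonal entries
  (\<open>left_product_triangular\<close>). The two basis vectors are treated at once by working with an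
  arbitrary pair of distinct indices \<open>i\<close> and \<open>j\<close>. All conditions concern the tail of the sequence:
  a fixed initial block only multiplies the products from the right.
\<close>

section \<open>Left products\<close>

lemma left_product_Suc:
  "m \<le> Suc n \<Longrightarrow> left_product M m (Suc n) = M (Suc n) ** left_product M m n"
  by (simp add: left_product_def)

lemma left_product_refl: "left_product M m m = M m"
  by (simp add: left_product_def)

lemma left_product_split:
  assumes "m \<le> k" "k \<le> n"
  shows "left_product M m n = left_product M (Suc k) n ** left_product M m k"
  using assms(2)
proof (induction n rule: dec_induct)
  case base
  show ?case by (simp add: left_product_def)
next
  case (step n)
  then show ?case using assms(1) by (simp add: left_product_Suc matrix_mul_assoc)
qed

lemma left_product_conjugate:
  assumes "D ** E = mat 1" "E ** D = mat 1"
  shows "left_product (\<lambda>n. E ** M n ** D) m n = E ** left_product M m n ** D"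
proof -
  \<comment> \<open>The initial value of the fold changes along the induction, so it cannot be the identity only.\<close>
  have "fold (\<lambda>k P. (E ** M k ** D) ** P) xs (E ** P ** D)
      = E ** fold (\<lambda>k P. M k ** P) xs P ** D" for xs P
  proof (induction xs arbitrary: P)
    case (Cons k xs)
    have "(E ** M k ** D) ** (E ** P ** D) = E ** M k ** (D ** E) ** P ** D"
      by (simp add: matrix_mul_assoc)
    also have "\<dots> = E ** (M k ** P) ** D"
      by (simp add: assms matrix_mul_assoc)
    finally show ?case using Cons by simp
  qed simp
  from this[of _ "mat 1"] show ?thesis by (simp add: left_product_def assms)
qed

lemma left_product_fixes:
  assumes "\<And>n. n \<ge> m \<Longrightarrow> M n *v v = v"
  shows "left_product M m n *v v = v"
proof -
  have fixes_fold: "fold (\<lambda>k P. M k ** P) xs P *v v = v"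
    if "set xs \<subseteq> {m..}" "P *v v = v" for xs P
    using that by (induction xs arbitrary: P)
      (auto simp: assms matrix_vector_mul_assoc[symmetric])
  show ?thesis unfolding left_product_def by (rule fixes_fold) auto
qed

lemma left_product_nonneg:
  fixes M :: "nat \<Rightarrow> real^'k^'k"
  assumes "\<And>n i j. n \<ge> m \<Longrightarrow> M n $ i $ j \<ge> 0"
  shows "left_product M m n $ i $ j \<ge> 0"
proof -
  have nonneg_fold: "\<forall>i j. fold (\<lambda>k P. M k ** P) xs P $ i $ j \<ge> 0"
    if "set xs \<subseteq> {m..}" "\<forall>i j. P $ i $ j \<ge> 0" for xs P
    using that
  proof (induction xs arbitrary: P)
    case (Cons k xs)
    then have "\<forall>i j. (M k ** P) $ i $ j \<ge> 0"
      by (auto simp: assms matrix_matrix_mult_def intro!: sum_nonneg mult_nonneg_nonneg)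
    with Cons show ?case by simp
  qed simp
  show ?thesis unfolding left_product_def
    by (rule nonneg_fold[rule_format]) (auto simp: mat_def)
qed

section \<open>Limits of matrix products\<close>

lemma tendsto_matrix_mult:
  fixes X :: "nat \<Rightarrow> real^'n^'m" and Y :: "nat \<Rightarrow> real^'k^'n"
  assumes "X \<longlonglongrightarrow> A" "Y \<longlonglongrightarrow> B"
  shows "(\<lambda>n. X n ** Y n) \<longlonglongrightarrow> A ** B"
  unfolding matrix_matrix_mult_def
  by (intro vec_tendstoI) (simp only: vec_lambda_beta, intro tendsto_sum tendsto_mult tendsto_vec_nth assms)

lemma convergent_matrix_mult:
  fixes X :: "nat \<Rightarrow> real^'n^'m" and Y :: "nat \<Rightarrow> real^'k^'n"
  assumes "convergent X" "convergent Y"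
  shows "convergent (\<lambda>n. X n ** Y n)"
  using assms tendsto_matrix_mult unfolding convergent_def by blast

lemma convergent_matrix_iff:
  fixes X :: "nat \<Rightarrow> real^'n^'m"
  shows "convergent X \<longleftrightarrow> (\<forall>i j. convergent (\<lambda>n. X n $ i $ j))"
proof
  assume "convergent X"
  then obtain L where "X \<longlonglongrightarrow> L" by (auto simp: convergent_def)
  then have "(\<lambda>n. X n $ i $ j) \<longlonglongrightarrow> L $ i $ j" for i j
    by (intro tendsto_vec_nth)
  then show "\<forall>i j. convergent (\<lambda>n. X n $ i $ j)" unfolding convergent_def by blast
next
  assume "\<forall>i j. convergent (\<lambda>n. X n $ i $ j)"
  then obtain l where "\<And>i j. (\<lambda>n. X n $ i $ j) \<longlonglongrightarrow> l i j"
    unfolding convergent_def by metis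
  then have "X \<longlonglongrightarrow> (\<chi> i j. l i j)"
    by (intro vec_tendstoI) simp
  then show "convergent X" unfolding convergent_def by blast
qed

text \<open>
  The product from rank \<open>m\<close> is the product from rank \<open>k\<close> times the fixed matrix
  \<open>M (k - 1) ** \<dots> ** M m\<close>. The converse fails, because this fixed matrix may be singular.
\<close>

lemma convergent_left_product_from_tail:
  fixes M :: "nat \<Rightarrow> real^'k^'k"
  assumes "m \<le> k" "convergent (left_product M k)"
  shows "convergent (left_product M m)"
proof (cases "m = k")
  case False
  with assms(1) obtain j where j: "k = Suc j" "m \<le> j" by (cases k) auto
  have "convergent (\<lambda>n. left_product M k n ** left_product M m j)"
    using assms(2) by (intro convergent_matrix_mult convergent_const)
  moreover have "\<forall>\<^sub>F n in sequentially. left_product M k n ** left_product M m j = left_product M m n"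
    using j(2) unfolding j(1)
    by (intro eventually_sequentiallyI[of j]) (rule left_product_split[symmetric])
  ultimately show ?thesis by (rule convergent_cong[THEN iffD1, rotated])
qed (use assms in simp)

text \<open>
  For a fixed matrix \<open>A\<close>, the difference \<open>A ** P n - P (Suc n)\<close> tends to \<open>A ** L - L\<close>, and it vanishes
  whenever \<open>M (Suc n) = A\<close>. So if \<open>A ** L \<noteq> L\<close>, the value \<open>A\<close> is no longer taken from a certain rank.
  Finitely many values \<open>A\<close> have a common such rank.
\<close>

lemma eventually_factor_fixes_limit:
  fixes M :: "nat \<Rightarrow> real^'k^'k"
  assumes fin: "finite (M ` {m..})" and lim: "left_product M m \<longlonglongrightarrow> L"
  shows "\<forall>\<^sub>F n in sequentially. M n ** L = L"
proof -
  have "\<forall>\<^sub>F n in sequentially. M (Suc n) = A \<longrightarrow> A ** L = L" for A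
  proof (cases "A ** L = L")
    case False
    have "(\<lambda>n. A ** left_product M m n - left_product M m (Suc n)) \<longlonglongrightarrow> A ** L - L"
      using lim by (intro tendsto_diff tendsto_matrix_mult tendsto_const LIMSEQ_Suc)
    then have "\<forall>\<^sub>F n in sequentially. A ** left_product M m n - left_product M m (Suc n) \<noteq> 0"
      using False by (intro tendsto_imp_eventually_ne) auto
    moreover have "\<forall>\<^sub>F n in sequentially. n \<ge> m" by (rule eventually_ge_at_top)
    ultimately show ?thesis
      by eventually_elim (auto simp: left_product_Suc)
  qed simp
  then have "\<forall>\<^sub>F n in sequentially. \<forall>A\<in>M ` {m..}. M (Suc n) = A \<longrightarrow> A ** L = L"
    using fin by (intro eventually_ball_finite) auto
  moreover have "\<forall>\<^sub>F n in sequentially. n \<ge> m" by (rule eventually_ge_at_top)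
  ultimately have "\<forall>\<^sub>F n in sequentially. M (Suc n) ** L = L"
    by eventually_elim auto
  then show ?thesis by (rule eventually_sequentially_Suc[THEN iffD1])
qed

text \<open>
  If \<open>m\<close> is beyond the rank from which \<open>v\<close> is a common eigenvector, then \<open>v\<close> is fixed by all products
  from rank \<open>m\<close>, hence by their limit.
\<close>

lemma limit_nonnull_if_common_eigenvector:
  fixes M :: "nat \<Rightarrow> real^'k^'k"
  assumes ev: "\<forall>\<^sub>F n in sequentially. right_eigenvector (M n) 1 v"
    and conv: "\<And>m. m \<ge> 1 \<Longrightarrow> convergent (left_product M m)"
  shows "\<forall>\<^sub>F m in sequentially. lim (left_product M m) \<noteq> 0"
proof -
  from ev obtain K where K: "\<And>n. n \<ge> K \<Longrightarrow> M n *v v = v" and "v \<noteq> 0"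
    by (auto simp: eventually_sequentially right_eigenvector_def)
  have "lim (left_product M m) \<noteq> 0" if m: "m \<ge> max 1 K" for m
  proof
    assume 0: "lim (left_product M m) = 0"
    have "left_product M m \<longlonglongrightarrow> 0"
      using conv[of m] m 0 by (simp add: convergent_LIMSEQ_iff)
    then have "(\<lambda>n. left_product M m n *v v) \<longlonglongrightarrow> 0 *v v"
      unfolding matrix_vector_mult_def
      by (intro vec_tendstoI)
        (simp only: vec_lambda_beta, intro tendsto_sum tendsto_mult tendsto_vec_nth tendsto_const)
    moreover have "left_product M m n *v v = v" for n
      using K m by (intro left_product_fixes) auto
    ultimately show False using \<open>v \<noteq> 0\<close> by (simp add: LIMSEQ_const_iff)
  qed
  then show ?thesis by (rule eventually_sequentiallyI)
qed

section \<open>Products of triangular matrices\<close>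

text \<open>
  Two distinct indices exhaust the type of indices. This lets the upper and the lower triangular
  case share their proofs, with \<open>(i, j)\<close> equal to \<open>(1, 2)\<close> or \<open>(2, 1)\<close>.
\<close>

lemma other_index_2:
  fixes i j :: 2
  assumes "i \<noteq> j"
  shows "(\<forall>k. P k) \<longleftrightarrow> P i \<and> P j" "sum f UNIV = f i + f j"
proof -
  have "k = i \<or> k = j" for k
    using assms exhaust_2[of i] exhaust_2[of j] exhaust_2[of k] by metis
  then have U: "UNIV = {i, j}" by blast
  have "(\<forall>k. P k) \<longleftrightarrow> (\<forall>k\<in>UNIV. P k)" by simp
  also have "\<dots> \<longleftrightarrow> P i \<and> P j" unfolding U by simp
  finally show "(\<forall>k. P k) \<longleftrightarrow> P i \<and> P j" .
  show "sum f UNIV = f i + f j" unfolding U using assms by simp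
qed

lemma right_eigenvector_axis_iff:
  fixes A :: "real^2^2"
  assumes "i \<noteq> j"
  shows "right_eigenvector A 1 (axis i 1) \<longleftrightarrow> A $ i $ i = 1 \<and> A $ j $ i = 0"
proof -
  have "A *v axis i 1 = column i A" by (rule matrix_vector_mult_basis)
  then show ?thesis using assms
    by (simp add: right_eigenvector_def axis_eq_0_iff vec_eq_iff other_index_2[OF assms]
        column_def) (simp add: axis_def)
qed

text \<open>
  Written with \<open>i\<close> first, the factors are the matrices with rows \<open>(1, q n)\<close> and \<open>(0, p n)\<close>. Multiplying
  a matrix with rows \<open>(1, s)\<close> and \<open>(0, t)\<close> by such a factor on the left yields the rows
  \<open>(1, s + q n * t)\<close> and \<open>(0, p n * t)\<close>.
\<close>

lemma left_product_triangular:
  fixes M :: "nat \<Rightarrow> real^2^2"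
  assumes ij: "i \<noteq> j"
    and tri: "\<And>n. n \<ge> m \<Longrightarrow> M n $ i $ i = 1 \<and> M n $ j $ i = 0"
    and q: "\<And>n. n \<ge> m \<Longrightarrow> M n $ i $ j = q n"
    and p: "\<And>n. n \<ge> m \<Longrightarrow> M n $ j $ j = p n"
  shows "left_product M m (m + r) $ i $ i = 1 \<and> left_product M m (m + r) $ j $ i = 0
    \<and> left_product M m (m + r) $ i $ j = (\<Sum>k\<le>r. q (m + k) * (\<Prod>l=m..<m + k. p l))
    \<and> left_product M m (m + r) $ j $ j = (\<Prod>l=m..m + r. p l)"
proof (induction r)
  case 0
  show ?case using tri q p by (simp add: left_product_refl)
next
  case (Suc r)
  let ?n = "m + Suc r"
  have step: "left_product M m ?n $ x $ y =
      M ?n $ x $ i * left_product M m (m + r) $ i $ y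
      + M ?n $ x $ j * left_product M m (m + r) $ j $ y" for x y
    by (simp add: left_product_Suc matrix_matrix_mult_def other_index_2(2)[OF ij])
  have factor: "M ?n $ i $ i = 1" "M ?n $ j $ i = 0" "M ?n $ i $ j = q ?n" "M ?n $ j $ j = p ?n"
    using tri q p by auto
  have prods: "(\<Prod>l=m..<?n. p l) = (\<Prod>l=m..m + r. p l)"
    "(\<Prod>l=m..?n. p l) = p ?n * (\<Prod>l=m..m + r. p l)"
    by (simp_all add: atLeastLessThanSuc_atLeastAtMost prod.nat_ivl_Suc')
  show ?case using Suc by (simp add: step factor prods del: add_Suc_right)
qed

lemma convergent_left_product_triangular_iff:
  fixes M :: "nat \<Rightarrow> real^2^2"
  assumes ij: "i \<noteq> j"
    and tri: "\<And>n. n \<ge> m \<Longrightarrow> M n $ i $ i = 1 \<and> M n $ j $ i = 0"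
    and q: "\<And>n. n \<ge> m \<Longrightarrow> M n $ i $ j = q n"
    and p: "\<And>n. n \<ge> m \<Longrightarrow> M n $ j $ j = p n"
  shows "convergent (left_product M m) \<longleftrightarrow>
    summable (\<lambda>k. q (m + k) * (\<Prod>l=m..<m + k. p l)) \<and> convergent (\<lambda>n. \<Prod>l=m..n. p l)"
proof -
  let ?P = "left_product M m"
  note entries = left_product_triangular[of i j m M q p, OF assms]
  have entry_ii: "\<And>r. ?P (m + r) $ i $ i = 1" and entry_ji: "\<And>r. ?P (m + r) $ j $ i = 0"
    and entry_ij: "\<And>r. ?P (m + r) $ i $ j = (\<Sum>k\<le>r. q (m + k) * (\<Prod>l=m..<m + k. p l))"
    and entry_jj: "\<And>r. ?P (m + r) $ j $ j = (\<Prod>l=m..m + r. p l)"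
    using entries by auto
  have "convergent ?P \<longleftrightarrow> convergent (\<lambda>r. ?P (m + r))"
    using convergent_ignore_initial_segment[of ?P m] by (simp only: add.commute)
  also have "\<dots> \<longleftrightarrow> convergent (\<lambda>r. \<Sum>k\<le>r. q (m + k) * (\<Prod>l=m..<m + k. p l))
      \<and> convergent (\<lambda>r. \<Prod>l=m..m + r. p l)"
    by (simp only: convergent_matrix_iff other_index_2(1)[OF ij] entry_ii entry_ij entry_ji entry_jj
        convergent_const simp_thms)
  also have "convergent (\<lambda>r. \<Prod>l=m..m + r. p l) \<longleftrightarrow> convergent (\<lambda>n. \<Prod>l=m..n. p l)"
    using convergent_ignore_initial_segment[of "\<lambda>n. \<Prod>l=m..n. p l" m] by (simp only: add.commute)
  finally show ?thesis by (simp only: summable_iff_convergent')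
qed

text \<open>
  Starting at \<open>m\<close> instead of \<open>K\<close> multiplies the terms of the series and the products by the constant
  \<open>p m * \<dots> * p (K - 1)\<close> and adds finitely many terms to the series.
\<close>

lemma triangular_series_and_product_from_tail:
  fixes p q :: "nat \<Rightarrow> real"
  assumes "m \<le> K" "summable (\<lambda>k. q (K + k) * (\<Prod>l=K..<K + k. p l))"
    and "convergent (\<lambda>n. \<Prod>l=K..n. p l)"
  shows "summable (\<lambda>k. q (m + k) * (\<Prod>l=m..<m + k. p l))" (is "summable ?f")
    and "convergent (\<lambda>n. \<Prod>l=m..n. p l)"
proof -
  define C where "C = (\<Prod>l=m..<K. p l)"
  have "?f (k + (K - m)) = C * (q (K + k) * (\<Prod>l=K..<K + k. p l))" for k
    using assms(1) prod.atLeastLessThan_concat[of m K "K + k" p]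
    by (simp add: C_def algebra_simps)
  then show "summable ?f"
    using assms(2) by (subst summable_iff_shift[of _ "K - m", symmetric]) (simp add: summable_mult)
  have "\<forall>\<^sub>F n in sequentially. C * (\<Prod>l=K..n. p l) = (\<Prod>l=m..n. p l)"
    using assms(1)
    by (auto simp: C_def atLeastLessThanSuc_atLeastAtMost[symmetric] prod.atLeastLessThan_concat
        intro!: eventually_sequentiallyI[of K])
  then show "convergent (\<lambda>n. \<Prod>l=m..n. p l)"
    using convergent_mult[OF convergent_const[of C] assms(3)] by (simp add: convergent_cong)
qed

text \<open>
  Beyond the rank \<open>K\<close> from which the factors are triangular, both sides are equivalent rank by rank.
  At a rank \<open>m\<close> below \<open>K\<close>, each condition is inherited from the same condition at the rank \<open>max m K\<close>.
\<close>

lemma left_products_convergent_iff_eventually_triangular: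
  fixes M :: "nat \<Rightarrow> real^2^2"
  assumes ij: "i \<noteq> j"
    and ev: "\<forall>\<^sub>F n in sequentially. right_eigenvector (M n) 1 (axis i 1)"
    and q: "\<And>n. n \<ge> 1 \<Longrightarrow> M n $ i $ j = q n"
    and p: "\<And>n. n \<ge> 1 \<Longrightarrow> M n $ j $ j = p n"
  shows "(\<forall>m\<ge>1. convergent (left_product M m)) \<longleftrightarrow>
    (\<forall>m\<ge>1. summable (\<lambda>k. q (m + k) * (\<Prod>l=m..<m + k. p l)) \<and>
      convergent (\<lambda>n. \<Prod>l=m..n. p l))"
    (is "?L \<longleftrightarrow> (\<forall>m\<ge>1. ?R m)")
proof -
  from ev obtain K where K: "\<And>n. n \<ge> K \<Longrightarrow> M n $ i $ i = 1 \<and> M n $ j $ i = 0"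
    by (auto simp: eventually_sequentially right_eigenvector_axis_iff[OF ij])
  have iff: "convergent (left_product M m) \<longleftrightarrow> ?R m" if "m \<ge> 1" "m \<ge> K" for m
    using that K p q by (intro convergent_left_product_triangular_iff[OF ij]) auto
  show ?thesis
  proof (intro iffI allI impI)
    fix m :: nat assume "?L" "m \<ge> 1"
    then have "?R (max m K)" using iff[of "max m K"] by auto
    then show "?R m"
      using triangular_series_and_product_from_tail[of m "max m K" q p] by auto
  next
    fix m :: nat assume "\<forall>m\<ge>1. ?R m" "m \<ge> 1"
    then have "convergent (left_product M (max m K))" using iff[of "max m K"] by auto
    then show "convergent (left_product M m)"
      by (rule convergent_left_product_from_tail[rotated]) simp
  qed
qed

section \<open>Rescaling to stochastic matrices\<close>

lemma mat2_nth [simp]: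
  "mat2 a b c d $ 1 $ 1 = a" "mat2 a b c d $ 1 $ 2 = b"
  "mat2 a b c d $ 2 $ 1 = c" "mat2 a b c d $ 2 $ 2 = d"
  by (simp_all add: mat2_def)

lemma diagonal_mat2_inverse:
  assumes "v1 \<noteq> 0" "v2 \<noteq> 0"
  shows "mat2 v1 0 0 v2 ** mat2 (1 / v1) 0 0 (1 / v2) = mat 1"
    and "mat2 (1 / v1) 0 0 (1 / v2) ** mat2 v1 0 0 v2 = mat 1"
  using assms by (simp_all add: vec_eq_iff forall_2 matrix_matrix_mult_def sum_2 mat_def)

lemma convergent_left_product_rescaled_iff:
  assumes "v1 \<noteq> 0" "v2 \<noteq> 0"
  shows "convergent (left_product (\<lambda>n. mat2 (1 / v1) 0 0 (1 / v2) ** M n ** mat2 v1 0 0 v2) m)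
    \<longleftrightarrow> convergent (left_product M m)"
proof -
  let ?D = "mat2 v1 0 0 v2" and ?E = "mat2 (1 / v1) 0 0 (1 / v2)"
  note inv = diagonal_mat2_inverse[OF assms]
  have conj: "left_product (\<lambda>n. ?E ** M n ** ?D) m = (\<lambda>n. ?E ** left_product M m n ** ?D)"
    using left_product_conjugate[OF inv] by blast
  have undo: "?D ** (?E ** X ** ?D) ** ?E = X" for X
  proof -
    have "?D ** (?E ** X ** ?D) ** ?E = (?D ** ?E) ** X ** (?D ** ?E)"
      by (simp only: matrix_mul_assoc)
    then show ?thesis by (simp only: inv matrix_mul_lid matrix_mul_rid)
  qed
  show ?thesis
  proof
    assume "convergent (left_product M m)"
    then show "convergent (left_product (\<lambda>n. ?E ** M n ** ?D) m)"
      unfolding conj by (intro convergent_matrix_mult convergent_const)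
  next
    assume "convergent (left_product (\<lambda>n. ?E ** M n ** ?D) m)"
    then have "convergent (\<lambda>n. ?D ** (?E ** left_product M m n ** ?D) ** ?E)"
      unfolding conj
      by (rule convergent_matrix_mult[OF convergent_matrix_mult[OF convergent_const] convergent_const])
    then show "convergent (left_product M m)" by (simp add: undo)
  qed
qed

text \<open>
  The rows of the rescaled matrix sum to \<open>(A *v v) $ i / v $ i\<close>, which is 1 for an eigenvector.
\<close>

lemma stochastic_rescaled:
  assumes "right_eigenvector A 1 (vector [v1, v2])" "v1 > 0" "v2 > 0" "\<And>i j. A $ i $ j \<ge> 0"
  shows "stochastic (mat2 (1 / v1) 0 0 (1 / v2) ** A ** mat2 v1 0 0 v2)"
proof -
  have "A $ 1 $ 1 * v1 + A $ 1 $ 2 * v2 = v1" "A $ 2 $ 1 * v1 + A $ 2 $ 2 * v2 = v2"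
    using assms(1) by (simp_all add: right_eigenvector_def vec_eq_iff forall_2 sum_2
        matrix_vector_mult_def)
  then show ?thesis using assms(2-4)
    by (simp add: stochastic_def forall_2 matrix_matrix_mult_def sum_2 field_simps)
qed

section \<open>The characterization\<close>

text \<open>
  The eigenvector is a nonzero column of the limit: its entries are limits of entries of nonnegative
  matrices, and it is fixed by every matrix that fixes the limit.
\<close>

lemma common_nonneg_eigenvector:
  fixes M :: "nat \<Rightarrow> real^'k^'k"
  assumes fin: "finite (M ` {m..})"
    and nonneg: "\<And>n i j. n \<ge> m \<Longrightarrow> M n $ i $ j \<ge> 0"
    and lim: "left_product M m \<longlonglongrightarrow> L" and "L \<noteq> 0"
  shows "\<exists>v. (\<forall>i. v $ i \<ge> 0) \<and> (\<forall>\<^sub>F n in sequentially. right_eigenvector (M n) 1 v)"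
proof -
  obtain i0 j where ij: "L $ i0 $ j \<noteq> 0" using \<open>L \<noteq> 0\<close> by (auto simp: vec_eq_iff)
  let ?v = "column j L"
  have "L $ i $ j \<ge> 0" for i
  proof (rule LIMSEQ_le_const)
    show "(\<lambda>n. left_product M m n $ i $ j) \<longlonglongrightarrow> L $ i $ j" using lim by (intro tendsto_vec_nth)
    show "\<exists>N. \<forall>n\<ge>N. 0 \<le> left_product M m n $ i $ j" using left_product_nonneg nonneg by blast
  qed
  then have "\<forall>i. ?v $ i \<ge> 0" by (simp add: column_def)
  moreover have "?v \<noteq> 0" using ij by (auto simp: column_def vec_eq_iff)
  moreover have "\<forall>\<^sub>F n in sequentially. M n *v ?v = ?v"
    using eventually_factor_fixes_limit[OF fin lim]
  proof eventually_elim
    case (elim n)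
    then show ?case
      by (metis matrix_vector_mul_assoc matrix_vector_mult_basis)
  qed
  ultimately show ?thesis by (intro exI[of _ ?v]) (simp add: right_eigenvector_def)
qed

lemma right_eigenvector_scaleD:
  assumes "right_eigenvector A e (t *s v)"
  shows "right_eigenvector A e v"
proof -
  have "t \<noteq> 0" "v \<noteq> 0" using assms by (auto simp: right_eigenvector_def)
  have "t *s (A *v v) = t *s (e *s v)"
    using assms by (simp add: right_eigenvector_def vector_scalar_commute mult.commute)
  then have "A *v v = e *s v" using \<open>t \<noteq> 0\<close> by (metis vector_mul_lcancel)
  then show ?thesis using \<open>v \<noteq> 0\<close> by (simp add: right_eigenvector_def)
qed

theorem proposition1p1:
  fixes M :: "nat \<Rightarrow> real^2^2" and a b c d :: "nat \<Rightarrow> real"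
  assumes M: "\<And>n. n \<ge> 1 \<Longrightarrow> M n = mat2 (a n) (b n) (c n) (d n)"
    and nonneg: "\<And>n. n \<ge> 1 \<Longrightarrow> a n \<ge> 0 \<and> b n \<ge> 0 \<and> c n \<ge> 0 \<and> d n \<ge> 0"
    and fin: "finite {M n | n. n \<ge> 1}"
  shows "(\<forall>m\<ge>1. convergent (\<lambda>n. left_product M m n)) \<and>
    (\<forall>\<^sub>F m in sequentially. lim (\<lambda>n. left_product M m n) \<noteq> 0) \<longleftrightarrow>
      (\<exists>v1 v2 :: real. v1 * v2 > 0 \<and>
        (\<forall>\<^sub>F n in sequentially. right_eigenvector (M n) 1 (vector [v1, v2])) \<and>
        (let S = (\<lambda>n. mat2 (1 / v1) 0 0 (1 / v2) ** M n ** mat2 v1 0 0 v2) in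
          (\<forall>\<^sub>F n in sequentially. stochastic (S n)) \<and>
          (\<forall>m\<ge>1. convergent (\<lambda>n. left_product S m n))))
    \<or> ((\<forall>\<^sub>F n in sequentially. right_eigenvector (M n) 1 (vector [1, 0])) \<and>
        (\<forall>m\<ge>1. summable (\<lambda>k. b (m + k) * (\<Prod>j=m..<m + k. d j)) \<and>
               convergent (\<lambda>n. \<Prod>j=m..n. d j)))
    \<or> ((\<forall>\<^sub>F n in sequentially. right_eigenvector (M n) 1 (vector [0, 1])) \<and>
        (\<forall>m\<ge>1. summable (\<lambda>k. c (m + k) * (\<Prod>j=m..<m + k. a j)) \<and>
               convergent (\<lambda>n. \<Prod>j=m..n. a j)))"
    (is "?conv \<and> ?nonnull \<longleftrightarrow> ?case1 \<or> ?case2 \<or> ?case3")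
proof -
  have e1: "vector [1, 0] = (axis 1 1 :: real^2)" and e2: "vector [0, 1] = (axis 2 1 :: real^2)"
    by (simp_all add: vec_eq_iff forall_2 axis_def)
  have entry_nonneg: "M n $ i $ j \<ge> 0" if "n \<ge> 1" for n i j
    using M[OF that] nonneg[OF that] exhaust_2[of i] exhaust_2[of j] by auto
  have case1_conv: ?conv
    if "v1 * v2 > 0"
      "\<forall>m\<ge>1. convergent (left_product (\<lambda>n. mat2 (1 / v1) 0 0 (1 / v2) ** M n ** mat2 v1 0 0 v2) m)"
    for v1 v2 :: real
    using that convergent_left_product_rescaled_iff[of v1 v2 M] by (auto simp: zero_less_mult_iff)
  \<comment> \<open>If a basis vector is the common eigenvector, the series and the products describe convergence
    of the matrix products exactly, so these two equivalences serve both directions.\<close>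
  have case2_iff: "?case2 \<longleftrightarrow>
      ?conv \<and> (\<forall>\<^sub>F n in sequentially. right_eigenvector (M n) 1 (vector [1, 0]))"
    using left_products_convergent_iff_eventually_triangular[of 1 2 M b d] M by (auto simp: e1)
  have case3_iff: "?case3 \<longleftrightarrow>
      ?conv \<and> (\<forall>\<^sub>F n in sequentially. right_eigenvector (M n) 1 (vector [0, 1]))"
    using left_products_convergent_iff_eventually_triangular[of 2 1 M c a] M by (auto simp: e2)
  show ?thesis
  proof
    assume lhs: "?conv \<and> ?nonnull"
    then have "\<forall>\<^sub>F m in sequentially. m \<ge> 1 \<and> lim (left_product M m) \<noteq> 0"
      by (intro eventually_conj eventually_ge_at_top) simp
    then obtain m where m: "m \<ge> 1" "lim (left_product M m) \<noteq> 0"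
      by (auto dest: eventually_happens)
    have "left_product M m \<longlonglongrightarrow> lim (left_product M m)"
      using lhs m(1) by (simp add: convergent_LIMSEQ_iff)
    moreover have "finite (M ` {m..})"
      using m(1) by (intro finite_subset[OF _ fin]) auto
    moreover have "M n $ i $ j \<ge> 0" if "n \<ge> m" for n i j
      using that m(1) by (intro entry_nonneg) simp
    ultimately have "\<exists>v. (\<forall>i. v $ i \<ge> 0) \<and>
        (\<forall>\<^sub>F n in sequentially. right_eigenvector (M n) 1 v)"
      using m(2) by (intro common_nonneg_eigenvector[of M m])
    then obtain v where v: "\<And>i. v $ i \<ge> 0"
      and ev: "\<forall>\<^sub>F n in sequentially. right_eigenvector (M n) 1 v"
      by blast
    have v_eq: "vector [v $ 1, v $ 2] = v" by (simp add: vec_eq_iff forall_2)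
    consider "v $ 1 > 0" "v $ 2 > 0" | "v $ 2 = 0" | "v $ 1 = 0"
      using v[of 1] v[of 2] by linarith
    then show "?case1 \<or> ?case2 \<or> ?case3"
    proof cases
      case 1
      let ?S = "\<lambda>n. mat2 (1 / v $ 1) 0 0 (1 / v $ 2) ** M n ** mat2 (v $ 1) 0 0 (v $ 2)"
      from ev have "\<forall>\<^sub>F n in sequentially. right_eigenvector (M n) 1 (vector [v $ 1, v $ 2])"
        using v_eq by simp
      moreover from this eventually_ge_at_top[of 1] have "\<forall>\<^sub>F n in sequentially. stochastic (?S n)"
        by eventually_elim (use 1 entry_nonneg in \<open>auto intro: stochastic_rescaled\<close>)
      moreover have "\<forall>m\<ge>1. convergent (left_product ?S m)"
        using lhs 1 by (simp add: convergent_left_product_rescaled_iff)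
      ultimately have ?case1
        using 1 by (intro exI[of _ "v $ 1"] exI[of _ "v $ 2"]) (simp add: Let_def)
      then show ?thesis by simp
    next
      case 2
      then have v_eq: "v $ 1 *s vector [1, 0] = v" by (simp add: vec_eq_iff forall_2)
      have "\<forall>\<^sub>F n in sequentially. right_eigenvector (M n) 1 (vector [1, 0])"
        using ev by eventually_elim (rule right_eigenvector_scaleD, subst v_eq)
      then show ?thesis using case2_iff lhs by simp
    next
      case 3
      then have v_eq: "v $ 2 *s vector [0, 1] = v" by (simp add: vec_eq_iff forall_2)
      have "\<forall>\<^sub>F n in sequentially. right_eigenvector (M n) 1 (vector [0, 1])"
        using ev by eventually_elim (rule right_eigenvector_scaleD, subst v_eq)
      then show ?thesis using case3_iff lhs by simp
    qed
  next
    assume rhs: "?case1 \<or> ?case2 \<or> ?case3"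
    then have ?conv using case1_conv case2_iff case3_iff by (auto simp: Let_def)
    moreover obtain v where "\<forall>\<^sub>F n in sequentially. right_eigenvector (M n) 1 v"
      using rhs by blast
    ultimately show "?conv \<and> ?nonnull"
      using limit_nonnull_if_common_eigenvector[of M v] by simp
  qed
qed

end
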